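(* Let $t\geq 2$ and let $m_1,m_2$ and $n_1,\ldots,n_t$ be positive integers such that $m_2\geq n_i\geq 2 \lceil \log (35^{2^{t}-2}(32m_1+49m_2))\rceil+2$ for each $1\leq i\leq t$. Then $$R(C_{n_1},\ldots,C_{n_t},K_{m_1,m_2})\leq 35^{2^{t}-2}(32m_1+49m_2).$$
   Context: $C_k$ denotes the cycle on $k$ vertices and $K_{a,b}$ the complete bipartite graph with parts of sizes $a$ and $b$. For graphs $G_1,\ldots,G_k$, the Ramsey number $R(G_1,\ldots,G_k)$ is the smallest integer $N$ such that for every coloring of the edges of the complete graph $K_N$ with colors $1,\ldots,k$ there is, for some $i$, a copy of $G_i$ all of whose edges have color $i$. $\log$ denotes the logarithm to base $2$. *)

theory Defs
  imports Complex_Main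
begin

text \<open>A (simple) graph is given by a vertex set and a symmetric edge predicate.\<close>
type_synonym graph = "nat set \<times> (nat \<Rightarrow> nat \<Rightarrow> bool)"

definition cycle_graph :: "nat \<Rightarrow> graph" where
  "cycle_graph n = ({..<n}, (\<lambda>u v. u \<noteq> v \<and> (v = (u + 1) mod n \<or> u = (v + 1) mod n)))"

definition complete_bipartite :: "nat \<Rightarrow> nat \<Rightarrow> graph" where
  "complete_bipartite a b = ({..<a+b}, (\<lambda>u v. (u < a \<and> a \<le> v) \<or> (v < a \<and> a \<le> u)))"

text \<open>An edge colouring of K_N (vertices {..<N}) is a map from 2-sets to colours.
  The colouring c contains a copy of G all of whose edges have colour i.\<close>
definition has_mono_copy :: "nat \<Rightarrow> (nat set \<Rightarrow> nat) \<Rightarrow> graph \<Rightarrow> nat \<Rightarrow> bool" where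
  "has_mono_copy N c G i \<longleftrightarrow>
     (\<exists>f. inj_on f (fst G) \<and> f ` fst G \<subseteq> {..<N} \<and>
          (\<forall>u\<in>fst G. \<forall>v\<in>fst G. snd G u v \<longrightarrow> c {f u, f v} = i))"

definition ramsey_prop :: "graph list \<Rightarrow> nat \<Rightarrow> bool" where
  "ramsey_prop Gs N \<longleftrightarrow>
     (\<forall>c. (\<forall>x<N. \<forall>y<N. x \<noteq> y \<longrightarrow> c {x, y} < length Gs) \<longrightarrow>
          (\<exists>i<length Gs. has_mono_copy N c (Gs ! i) i))"

definition ramsey_number :: "graph list \<Rightarrow> nat" where
  "ramsey_number Gs = (LEAST N. ramsey_prop Gs N)"

end

theory Submission
  imports Defs
begin

text \<open>
  By induction on the number \<open>t\<close> of cycle colours, a coloured complete graph on at least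
  \<open>threshold t * m\<close> vertices contains one of the desired cycles or a complete bipartite graph
  with parts of size \<open>m\<close> avoiding all \<open>t\<close> colours. In the step, the induction hypothesis for the
  first \<open>t\<close> colours, with \<open>m\<close> enlarged, yields large sets \<open>A\<close>, \<open>B\<close> between which these colours do
  not occur; we may assume that the next colour occurs between any \<open>m\<close>-subset of \<open>A\<close> and any
  \<open>m\<close>-subset of \<open>B\<close>.

  In such a bipartite graph, after deletion of at most \<open>2 * m\<close> exceptional vertices, any two
  vertices \<open>x\<close>, \<open>y\<close> are joined by paths of every admissible length of the right parity: grow
  disjoint binary trees from \<open>x\<close> and \<open>y\<close> until they have \<open>m\<close> leaves, find a long path in the rest
  by depth-first search, and choose a segment of it of the right length whose ends are adjacent to
  leaves of the two trees. A cycle of even length is closed by an edge between \<open>A\<close> and \<open>B\<close>. A cycle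
  of odd length is closed by an edge inside \<open>A\<close>, which exists by the induction hypothesis applied
  a second time, inside \<open>A\<close>; hence the squaring in the recursion for the threshold.
\<close>

section \<open>Expansion and long paths in bipartite graphs without large holes\<close>

locale bipartite_hole_free =
  fixes E :: "'a \<Rightarrow> 'a \<Rightarrow> bool" and A B :: "'a set" and m :: nat
  assumes finA: "finite A" and finB: "finite B" and disj: "A \<inter> B = {}"
    and sym: "E u v \<Longrightarrow> E v u"
    and bip: "E u v \<Longrightarrow> u \<in> A \<and> v \<in> B \<or> u \<in> B \<and> v \<in> A"
    and hole_free: "\<lbrakk>X \<subseteq> A; Y \<subseteq> B; m \<le> card X; m \<le> card Y\<rbrakk> \<Longrightarrow> \<exists>x\<in>X. \<exists>y\<in>Y. E x y"
    and m_pos: "0 < m"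
    and cardA: "25 * m \<le> card A" and cardB: "25 * m \<le> card B"
begin

definition nbrs :: "'a set \<Rightarrow> 'a set" where
  "nbrs X = {v. \<exists>x\<in>X. E x v}"

lemma swap: "bipartite_hole_free E B A m"
proof
  fix X Y assume "X \<subseteq> B" "Y \<subseteq> A" "m \<le> card X" "m \<le> card Y"
  then show "\<exists>x\<in>X. \<exists>y\<in>Y. E x y"
    using hole_free[of Y X] sym by blast
next
  show "u \<in> B \<and> v \<in> A \<or> u \<in> A \<and> v \<in> B" if "E u v" for u v using bip[OF that] by blast
qed (use finA finB disj sym m_pos cardA cardB in auto)

lemma nbrs_subset: "nbrs X \<subseteq> A \<union> B"
  using bip by (auto simp: nbrs_def)

lemma finite_nbrs: "finite (nbrs X)"
  using nbrs_subset finA finB by (meson finite_UnI finite_subset)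

lemma card_non_nbrs_less:
  assumes "X \<subseteq> A \<and> Y \<subseteq> B \<or> X \<subseteq> B \<and> Y \<subseteq> A" "m \<le> card X" "Y \<inter> nbrs X = {}"
  shows "card Y < m"
proof (rule ccontr)
  assume "\<not> card Y < m"
  then have "\<exists>x\<in>X. \<exists>y\<in>Y. E x y"
    using assms(1,2) hole_free[of X Y] hole_free[of Y X] sym by (meson not_less)
  then show False using assms(3) by (auto simp: nbrs_def)
qed

lemma card_nbrs_side:
  assumes "m \<le> card (X \<inter> A)"
  shows "24 * m < card (nbrs X)"
proof -
  have "card (B - nbrs X) < m"
    by (rule card_non_nbrs_less[of "X \<inter> A"]) (use assms in \<open>auto simp: nbrs_def\<close>)
  moreover have "card B \<le> card (nbrs X) + card (B - nbrs X)"
    using card_Un_le[of "nbrs X" "B - nbrs X"] card_mono[of "nbrs X \<union> (B - nbrs X)" B]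
      finB finite_nbrs[of X] by fastforce
  ultimately show ?thesis using cardB by linarith
qed

text \<open>One side of the bipartition contains at least \<open>m\<close> vertices of
  \<open>X\<close>, and these miss fewer than \<open>m\<close> of the at least \<open>25 * m\<close>
  vertices on the other side.\<close>

lemma card_nbrs_large:
  assumes "X \<subseteq> A \<union> B" "2 * m \<le> card X"
  shows "24 * m < card (nbrs X)"
proof (cases "m \<le> card (X \<inter> A)")
  case True
  then show ?thesis by (rule card_nbrs_side)
next
  case False
  interpret sw: bipartite_hole_free E B A m by (rule swap)
  have "card X \<le> card (X \<inter> A) + card (X \<inter> B)"
    using card_Un_le[of "X \<inter> A" "X \<inter> B"] assms(1) by (metis Int_Un_distrib inf.absorb1)
  then have "m \<le> card (X \<inter> B)" using False assms(2) by linarith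
  then show ?thesis using sw.card_nbrs_side by (simp add: sw.nbrs_def nbrs_def)
qed

text \<open>\<open>W\<close> is a poorly expanding set of maximal size. If a small \<open>S\<close>
  outside \<open>W\<close> expanded poorly, so would \<open>W \<union> S\<close>. By maximality this
  union would have more than \<open>2 * m\<close> vertices; having at most \<open>3 * m\<close>, it
  would have at most \<open>24 * m\<close> neighbours, contradicting
  \<open>card_nbrs_large\<close>.\<close>

lemma ex_exceptional_set:
  obtains W where "W \<subseteq> A \<union> B" "card W \<le> 2 * m"
    "\<And>S. \<lbrakk>S \<subseteq> A \<union> B - W; card S \<le> m\<rbrakk> \<Longrightarrow> 7 * card S \<le> card (nbrs S - W - S)"
proof -
  define P where "P W \<longleftrightarrow> W \<subseteq> A \<union> B \<and> card W \<le> 2 * m \<and> card (nbrs W - W) \<le> 7 * card W" for W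
  have "P {}" by (simp add: P_def nbrs_def)
  then obtain W where W: "P W" and mx: "\<And>W'. P W' \<Longrightarrow> card W' \<le> card W"
    using ex_has_greatest_nat[of P "{}" card "Suc (2 * m)"] by (auto simp: P_def less_Suc_eq_le)
  have "7 * card S \<le> card (nbrs S - W - S)" if S: "S \<subseteq> A \<union> B - W" "card S \<le> m" for S
  proof (rule ccontr)
    assume neg: "\<not> ?thesis"
    then have "S \<noteq> {}" by auto
    have finS: "finite S" and finW: "finite W"
      using S W finA finB by (auto simp: P_def intro: finite_subset[of _ "A \<union> B"])
    have cu: "card (W \<union> S) = card W + card S"
      using S finS finW by (intro card_Un_disjoint) auto
    have "nbrs (W \<union> S) - (W \<union> S) \<subseteq> (nbrs W - W) \<union> (nbrs S - W - S)"
      by (auto simp: nbrs_def)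
    then have "card (nbrs (W \<union> S) - (W \<union> S)) \<le> card ((nbrs W - W) \<union> (nbrs S - W - S))"
      by (intro card_mono) (auto simp: finite_nbrs)
    also have "\<dots> \<le> card (nbrs W - W) + card (nbrs S - W - S)" by (rule card_Un_le)
    also have "\<dots> \<le> 7 * card (W \<union> S)" using neg W cu by (simp add: P_def)
    finally have bd: "card (nbrs (W \<union> S) - (W \<union> S)) \<le> 7 * card (W \<union> S)" .
    have "card S > 0" using \<open>S \<noteq> {}\<close> finS by (simp add: card_gt_0_iff)
    then have "\<not> P (W \<union> S)" using mx[of "W \<union> S"] cu by auto
    then have big: "2 * m < card (W \<union> S)" using bd S W by (auto simp: P_def)
    have "24 * m < card (nbrs (W \<union> S))"
      using big S W by (intro card_nbrs_large) (auto simp: P_def)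
    also have "\<dots> \<le> card ((nbrs (W \<union> S) - (W \<union> S)) \<union> (W \<union> S))"
      by (rule card_mono) (use finS finW finite_nbrs in auto)
    also have "\<dots> \<le> 8 * card (W \<union> S)"
      using card_Un_le[of "nbrs (W \<union> S) - (W \<union> S)" "W \<union> S"] bd by linarith
    also have "\<dots> \<le> 24 * m" using cu S W by (simp add: P_def)
    finally show False by simp
  qed
  then show ?thesis using that W by (auto simp: P_def)
qed

text \<open>Depth-first search: \<open>D\<close> collects the vertices already backtracked from, so there are no
  edges between \<open>D\<close> and the unexplored vertices, and \<open>2 * card D + length p\<close> increases by one
  in every step.\<close>

lemma ex_long_path:
  assumes Z: "card Z \<le> 10 * m" "finite Z"
  obtains p where "distinct p" "successively E p" "set p \<subseteq> A \<union> B - Z" "5 * m \<le> length p"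
proof (rule ccontr)
  assume "\<not> thesis"
  then have no: "\<And>p. \<lbrakk>distinct p; successively E p; set p \<subseteq> A \<union> B - Z\<rbrakk> \<Longrightarrow> length p < 5 * m"
    using that by (meson not_less)
  define st where "st D p \<longleftrightarrow> D \<subseteq> A \<union> B - Z \<and> card D \<le> 2 * m \<and> set p \<subseteq> A \<union> B - Z - D \<and>
     distinct p \<and> successively E p \<and> nbrs D \<subseteq> Z \<union> D \<union> set p" for D p
  have "\<exists>D p. st D p \<and> 2 * card D + length p = k" for k
  proof (induction k)
    case 0
    show ?case by (rule exI[of _ "{}"], rule exI[of _ "[]"]) (simp add: st_def nbrs_def)
  next
    case (Suc k)
    then obtain D p where D: "st D p" and k: "2 * card D + length p = k" by blast
    have finD: "finite D" using D finA finB unfolding st_def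
      by (meson finite_Diff finite_UnI finite_subset)
    have len: "length p < 5 * m" using D by (intro no) (auto simp: st_def)
    have cp: "card (Z \<union> D \<union> set p) \<le> card Z + card D + length p"
      using card_Un_le[of "Z \<union> D" "set p"] card_Un_le[of Z D] card_length[of p] by linarith
    \<comment> \<open>All neighbours of \<open>D\<close> lie in
      \<open>Z \<union> D \<union> set p\<close>. With \<open>2 * m\<close> vertices in
      \<open>D\<close> this set would have fewer than \<open>(10 + 2 + 5) * m\<close> elements,
      against more than \<open>24 * m\<close> neighbours.\<close>
    have less: "card D < 2 * m"
    proof (rule ccontr)
      assume "\<not> ?thesis"
      then have "24 * m < card (nbrs D)" using D by (intro card_nbrs_large) (auto simp: st_def)
      also have "\<dots> \<le> card (Z \<union> D \<union> set p)"
        using D finD Z by (intro card_mono) (auto simp: st_def)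
      finally show False using cp D Z len by (simp add: st_def)
    qed
    show ?case
    proof (cases p)
      case Nil
      have "\<not> A \<subseteq> Z \<union> D"
      proof
        assume "A \<subseteq> Z \<union> D"
        then have "card A \<le> card (Z \<union> D \<union> set p)" using finD Z by (intro card_mono) auto
        then show False using cp cardA m_pos less Z len by linarith
      qed
      then obtain u where "u \<in> A" "u \<notin> Z \<union> D" by blast
      then have "st D [u]" using D Nil by (auto simp: st_def)
      then show ?thesis using k Nil by (intro exI[of _ D] exI[of _ "[u]"]) simp
    next
      \<comment> \<open>The path grows at its head \<open>u\<close>; once \<open>u\<close> has no
        unexplored neighbour, it moves to \<open>D\<close>.\<close>
      case (Cons u q)
      show ?thesis
      proof (cases "\<exists>v. E u v \<and> v \<notin> Z \<union> D \<union> set p")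
        case True
        then obtain v where v: "E u v" "v \<notin> Z \<union> D \<union> set p" by blast
        then have "st D (v # p)" using D Cons sym[OF v(1)] bip[OF v(1)] by (auto simp: st_def)
        then show ?thesis using k by (intro exI[of _ D] exI[of _ "v # p"]) simp
      next
        case False
        then have "nbrs (insert u D) \<subseteq> Z \<union> insert u D \<union> set q"
          using D Cons by (auto simp: st_def nbrs_def)
        moreover have "u \<notin> D" using D Cons by (auto simp: st_def)
        ultimately have "st (insert u D) q" "card (insert u D) = Suc (card D)"
          using D Cons less finD by (auto simp: st_def successively_Cons)
        then show ?thesis using k Cons by (intro exI[of _ "insert u D"] exI[of _ q]) simp
      qed
    qed
  qed
  \<comment> \<open>At the total \<open>9 * m\<close>, the bound \<open>card D \<le> 2 * m\<close>
    leaves at least \<open>5 * m\<close> vertices on the path.\<close>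
  then obtain D p where D: "st D p" "2 * card D + length p = 9 * m" by blast
  moreover have "length p < 5 * m" using D by (intro no) (auto simp: st_def)
  ultimately show False by (simp add: st_def)
qed

section \<open>Disjoint trees and connecting paths of prescribed length\<close>

text \<open>This describes a tree on \<open>S\<close> with root \<open>x\<close> and last level
  \<open>L\<close> at depth \<open>j\<close>. Levels double in size, but a vertex need not have
  exactly two children; only the size of \<open>S\<close> and the paths from leaves to the root are
  recorded.\<close>

definition leaves :: "'a \<Rightarrow> nat \<Rightarrow> 'a set \<Rightarrow> 'a set \<Rightarrow> bool" where
  "leaves x j S L \<longleftrightarrow> finite S \<and> card S < 2 ^ Suc j \<and> L \<subseteq> S \<and> card L = 2 ^ j \<and>
     (\<forall>u\<in>L. \<exists>p. distinct p \<and> successively E p \<and> set p \<subseteq> S \<and> length p = Suc j \<and>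
        p \<noteq> [] \<and> hd p = u \<and> last p = x)"

lemma leaves_0: "leaves x 0 {x} {x}"
  by (auto simp: leaves_def intro!: exI[of _ "[x]"])

lemma leaves_Suc:
  assumes L: "leaves x j S L" and Z: "S \<subseteq> Z" "2 ^ Suc j \<le> card (nbrs L - Z)"
  obtains L' where "L' \<subseteq> nbrs L - Z" "leaves x (Suc j) (S \<union> L') L'"
proof -
  obtain L' where L': "L' \<subseteq> nbrs L - Z" "card L' = 2 ^ Suc j" "finite L'"
    using Z(2) by (rule obtain_subset_with_card_n)
  have "card (S \<union> L') < 2 ^ Suc (Suc j)"
    using card_Un_le[of S L'] L L' by (simp add: leaves_def)
  moreover have "\<exists>p. distinct p \<and> successively E p \<and> set p \<subseteq> S \<union> L' \<and> length p = Suc (Suc j) \<and>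
        p \<noteq> [] \<and> hd p = v \<and> last p = x" if "v \<in> L'" for v
  proof -
    from that L' obtain u where u: "u \<in> L" "E u v" "v \<notin> Z" by (auto simp: nbrs_def)
    then obtain p where p: "distinct p" "successively E p" "set p \<subseteq> S" "length p = Suc j"
      "p \<noteq> []" "hd p = u" "last p = x" using L unfolding leaves_def by blast
    then show ?thesis using u Z that sym[OF u(2)]
      by (intro exI[of _ "v # p"]) (auto simp: successively_Cons)
  qed
  ultimately have "leaves x (Suc j) (S \<union> L') L'"
    using L L' unfolding leaves_def by auto
  then show ?thesis using that L' by blast
qed

text \<open>The two trees gain their levels alternately. A level of \<open>2 ^ j\<close> vertices
  expands by a factor of 7, which leaves enough neighbours outside both trees for a level of twice
  the size.\<close>

lemma ex_disjoint_trees: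
  assumes W: "\<And>S. \<lbrakk>S \<subseteq> A \<union> B - W; card S \<le> m\<rbrakk> \<Longrightarrow> 7 * card S \<le> card (nbrs S - W - S)"
    and xy: "x \<in> A \<union> B - W" "y \<in> A \<union> B - W" "x \<noteq> y"
  shows "\<lbrakk>\<And>i. i < j \<Longrightarrow> 2 ^ i \<le> m\<rbrakk> \<Longrightarrow> \<exists>S L T M. leaves x j S L \<and> leaves y j T M \<and>
    S \<inter> T = {} \<and> S \<union> T \<subseteq> A \<union> B - W"
proof (induction j)
  case 0
  show ?case
    by (rule exI[of _ "{x}"], rule exI[of _ "{x}"], rule exI[of _ "{y}"], rule exI[of _ "{y}"])
      (use xy leaves_0 in auto)
next
  case (Suc j)
  then have "2 ^ i \<le> m" if "i < j" for i using that by simp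
  from Suc.IH[OF this] obtain S L T M where ST: "leaves x j S L" "leaves y j T M" "S \<inter> T = {}"
    "S \<union> T \<subseteq> A \<union> B - W" by blast
  \<comment> \<open>Of \<open>7 * 2 ^ j\<close> neighbours, fewer than \<open>2 ^ j\<close> lie in
    earlier levels of the same tree and fewer than \<open>4 * 2 ^ j\<close> in the other one. The
    factor 4 covers the case that the other tree already has its new level.\<close>
  have room: "2 ^ Suc j \<le> card (nbrs L' - (W \<union> S' \<union> T'))"
    if h: "leaves z j S' L'" "S' \<subseteq> A \<union> B - W" "finite T'" "card T' < 4 * 2 ^ j" for z S' L' T'
  proof -
    have L': "L' \<subseteq> S'" "card L' = 2 ^ j" "card S' < 2 * 2 ^ j" "finite S'"
      using h by (auto simp: leaves_def)
    have "7 * 2 ^ j \<le> card (nbrs L' - W - L')"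
      using W[of L'] L' h Suc.prems[of j] by auto
    also have "\<dots> \<le> card ((nbrs L' - (W \<union> S' \<union> T')) \<union> ((S' - L') \<union> T'))"
      by (rule card_mono) (use finite_nbrs L' h in auto)
    also have "\<dots> \<le> card (nbrs L' - (W \<union> S' \<union> T')) + (card (S' - L') + card T')"
      by (meson card_Un_le add_left_mono order_trans)
    also have "card (S' - L') = card S' - card L'"
      using L' by (meson card_Diff_subset finite_subset)
    finally show ?thesis using L' h by simp
  qed
  have "2 ^ Suc j \<le> card (nbrs L - (W \<union> S \<union> T))"
    by (rule room[OF ST(1)]) (use ST in \<open>auto simp: leaves_def\<close>)
  with ST(1) obtain L' where L': "L' \<subseteq> nbrs L - (W \<union> S \<union> T)" "leaves x (Suc j) (S \<union> L') L'"
    by (meson leaves_Suc Un_upper1 Un_upper2 order_trans)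
  have "2 ^ Suc j \<le> card (nbrs M - (W \<union> T \<union> (S \<union> L')))"
    by (rule room[OF ST(2)]) (use ST L' in \<open>auto simp: leaves_def\<close>)
  with ST(2) obtain M' where M': "M' \<subseteq> nbrs M - (W \<union> T \<union> (S \<union> L'))" "leaves y (Suc j) (T \<union> M') M'"
    by (meson leaves_Suc Un_upper1 Un_upper2 order_trans)
  have "(S \<union> L') \<inter> (T \<union> M') = {}" "(S \<union> L') \<union> (T \<union> M') \<subseteq> A \<union> B - W"
    using ST L'(1) M'(1) nbrs_subset by blast+
  with L' M' show ?case by blast
qed

lemma path_side:
  assumes "successively E p" "i < length p"
  shows "p ! i \<in> A \<longleftrightarrow> (p ! 0 \<in> A \<longleftrightarrow> even i)"
  using assms(2)
proof (induction i)
  case (Suc i)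
  then have "E (p ! i) (p ! Suc i)" using assms(1) by (simp add: successively_conv_nth)
  then have "p ! Suc i \<in> A \<longleftrightarrow> p ! i \<notin> A" using bip disj by blast
  then show ?case using Suc by auto
qed simp

text \<open>The path consists of a branch from \<open>x\<close> to a leaf, a segment of a long path
  and a branch from a leaf to \<open>y\<close>. Among \<open>2 * m\<close> positions of the segment,
  fewer than \<open>m\<close> fail at each end, so one fits both trees.\<close>

lemma ex_path_of_length:
  assumes W: "card W \<le> 2 * m" "finite W"
    "\<And>S. \<lbrakk>S \<subseteq> A \<union> B - W; card S \<le> m\<rbrakk> \<Longrightarrow> 7 * card S \<le> card (nbrs S - W - S)"
    and xy: "x \<in> A \<union> B - W" "y \<in> A \<union> B - W" "x \<noteq> y"
    and d: "2 * m \<le> 2 ^ d" and n: "2 * d + 2 \<le> n" "n \<le> m"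
    and parity: "(x \<in> A \<longleftrightarrow> y \<in> A) \<longleftrightarrow> odd n"
  obtains p where "distinct p" "successively E p" "length p = n" "hd p = x" "last p = y"
proof -
  \<comment> \<open>Minimality gives \<open>2 ^ j \<le> 2 * m\<close>, so each tree has fewer than
    \<open>4 * m\<close> vertices and \<open>W\<close> with both trees has at most
    \<open>10 * m\<close>, as the path search requires.\<close>
  define j where "j = (LEAST j. m \<le> 2 ^ j)"
  obtain d' where d': "d = Suc d'" using d m_pos by (cases d) auto
  then have "m \<le> 2 ^ d'" using d by simp
  then have mj: "m \<le> 2 ^ j" and jd: "j \<le> d'"
    unfolding j_def by (rule LeastI, rule Least_le)
  have less: "2 ^ i < m" if "i < j" for i
    using not_less_Least[of i "\<lambda>j. m \<le> 2 ^ j"] that by (simp add: j_def)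
  have j2: "2 ^ j \<le> 2 * m" using less[of "j - 1"] m_pos by (cases j) auto
  have "\<exists>S L T M. leaves x j S L \<and> leaves y j T M \<and> S \<inter> T = {} \<and> S \<union> T \<subseteq> A \<union> B - W"
    using less by (intro ex_disjoint_trees W xy) (auto intro: less_imp_le)
  then obtain S L T M where LM: "leaves x j S L" "leaves y j T M" and ST: "S \<inter> T = {}"
    "S \<union> T \<subseteq> A \<union> B - W" by blast
  have "card (W \<union> S \<union> T) \<le> card W + card S + card T"
    using card_Un_le[of "W \<union> S" T] card_Un_le[of W S] by linarith
  also have "\<dots> \<le> 10 * m" using W LM j2 by (simp add: leaves_def)
  finally obtain p where p: "distinct p" "successively E p" "set p \<subseteq> A \<union> B - (W \<union> S \<union> T)"
    "5 * m \<le> length p" using ex_long_path[of "W \<union> S \<union> T"] LM W by (auto simp: leaves_def)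
  \<comment> \<open>The branches have \<open>j + 1\<close> vertices each and the segment has
    \<open>r + 1\<close>. The subtraction does not truncate, since \<open>j < d\<close> and
    \<open>2 * d + 2 \<le> n\<close>.\<close>
  define r where "r = n - 2 * j - 3"
  have r: "n = Suc j + (Suc r + Suc j)" using n jd d' by (simp add: r_def)
  have tree_side: "u \<in> A \<longleftrightarrow> (z \<in> A \<longleftrightarrow> even j)"
    if h: "leaves z j S' L'" "u \<in> L'" for z u S' L'
  proof -
    obtain q where q: "distinct q" "successively E q" "set q \<subseteq> S'" "length q = Suc j" "q \<noteq> []"
      "hd q = u" "last q = z" using h unfolding leaves_def by blast
    then have "q ! 0 = u" "q ! j = z" by (auto simp: hd_conv_nth last_conv_nth)
    then show ?thesis using path_side[of q j] q by auto
  qed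
  have LMsub: "L \<subseteq> A \<union> B" "M \<subseteq> A \<union> B" using LM ST by (auto simp: leaves_def)
  \<comment> \<open>The offset makes every candidate segment start on the side opposite to
    \<open>L\<close>.\<close>
  define i0 where "i0 = (if p ! 0 \<in> A \<longleftrightarrow> (x \<in> A \<longleftrightarrow> odd j) then 0 else 1::nat)"
  have idx: "i0 + 2 * k + r < length p" if "k < 2 * m" for k
  proof -
    have "r < m" "i0 \<le> 1" using r n by (auto simp: i0_def)
    then show ?thesis using that p by linarith
  qed
  have side1: "p ! (i0 + 2 * k) \<in> A \<longleftrightarrow> (x \<in> A \<longleftrightarrow> odd j)" if "k < 2 * m" for k
    using path_side[OF p(2), of "i0 + 2 * k"] idx[OF that] by (auto simp: i0_def)
  \<comment> \<open>The parity of \<open>n\<close> fixes that of \<open>r\<close>, so the segment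
    also ends on the side opposite to \<open>M\<close>.\<close>
  have side2: "p ! (i0 + 2 * k + r) \<in> A \<longleftrightarrow> (y \<in> A \<longleftrightarrow> odd j)" if "k < 2 * m" for k
  proof -
    have "odd n \<longleftrightarrow> even r" using r by auto
    then show ?thesis
      using path_side[OF p(2), of "i0 + 2 * k + r"] idx[OF that] parity by (auto simp: i0_def)
  qed
  have inAB: "p ! i \<in> A \<union> B" if "i < length p" for i using p(3) nth_mem[OF that] by blast
  have few: "card {k. k < 2 * m \<and> p ! (i0 + 2 * k + s) \<notin> nbrs L'} < m"
    if h: "leaves z j S' L'" "L' \<subseteq> A \<union> B" "s \<le> r"
      "\<And>k. k < 2 * m \<Longrightarrow> p ! (i0 + 2 * k + s) \<in> A \<longleftrightarrow> (z \<in> A \<longleftrightarrow> odd j)" for z S' L' s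
  proof -
    let ?K = "{k. k < 2 * m \<and> p ! (i0 + 2 * k + s) \<notin> nbrs L'}"
    let ?f = "\<lambda>k. p ! (i0 + 2 * k + s)"
    have ix: "i0 + 2 * k + s < length p" if "k < 2 * m" for k using idx[OF that] h(3) by linarith
    have "inj_on ?f ?K"
      using p(1) ix by (auto simp: inj_on_def nth_eq_iff_index_eq)
    then have "card ?K = card (?f ` ?K)" by (simp add: card_image)
    also have "\<dots> < m"
    proof (rule card_non_nbrs_less[of L'])
      have "u \<in> A \<longleftrightarrow> \<not> (z \<in> A \<longleftrightarrow> odd j)" if "u \<in> L'" for u
        using tree_side[OF h(1) that] by auto
      moreover have "?f k \<in> A \<union> B" if "k < 2 * m" for k using inAB ix that by blast
      ultimately show "L' \<subseteq> A \<and> ?f ` ?K \<subseteq> B \<or> L' \<subseteq> B \<and> ?f ` ?K \<subseteq> A"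
        using h(2,4) by (cases "z \<in> A \<longleftrightarrow> odd j") auto
    qed (use h mj in \<open>auto simp: leaves_def\<close>)
    finally show ?thesis .
  qed
  let ?K1 = "{k. k < 2 * m \<and> p ! (i0 + 2 * k + 0) \<notin> nbrs L}"
  let ?K2 = "{k. k < 2 * m \<and> p ! (i0 + 2 * k + r) \<notin> nbrs M}"
  have "card ?K1 < m" using side1 by (intro few[OF LM(1) LMsub(1)]) auto
  moreover have "card ?K2 < m" using side2 by (intro few[OF LM(2) LMsub(2)]) auto
  ultimately have "card (?K1 \<union> ?K2) < card {..<2 * m}"
    using card_Un_le[of ?K1 ?K2] by simp
  then have "\<not> {..<2 * m} \<subseteq> ?K1 \<union> ?K2"
    using card_mono[of "?K1 \<union> ?K2" "{..<2 * m}"] by fastforce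
  then obtain k where k: "k < 2 * m" "p ! (i0 + 2 * k) \<in> nbrs L" "p ! (i0 + 2 * k + r) \<in> nbrs M"
    by auto
  define i where "i = i0 + 2 * k"
  have ir: "i + r < length p" using idx[OF k(1)] by (simp add: i_def)
  define w where "w = take (Suc r) (drop i p)"
  have w: "length w = Suc r" "w \<noteq> []" "hd w = p ! i" "last w = p ! (i + r)" "distinct w"
    "set w \<subseteq> set p" "successively E w"
  proof -
    show lw: "length w = Suc r" using ir by (simp add: w_def)
    then show "w \<noteq> []" by auto
    then show "hd w = p ! i" "last w = p ! (i + r)"
      using lw ir by (auto simp: hd_conv_nth last_conv_nth w_def)
    show "distinct w" using p by (simp add: w_def)
    show "set w \<subseteq> set p" unfolding w_def by (meson order_trans set_drop_subset set_take_subset)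
    show "successively E w" using p(2) ir by (auto simp: successively_conv_nth w_def)
  qed
  obtain u v where uv: "u \<in> L" "E u (p ! i)" "v \<in> M" "E v (p ! (i + r))"
    using k by (auto simp: nbrs_def i_def)
  obtain a where a: "distinct a" "successively E a" "set a \<subseteq> S" "length a = Suc j"
    "a \<noteq> []" "hd a = u" "last a = x" using LM(1) uv unfolding leaves_def by blast
  obtain b where b: "distinct b" "successively E b" "set b \<subseteq> T" "length b = Suc j"
    "b \<noteq> []" "hd b = v" "last b = y" using LM(2) uv unfolding leaves_def by blast
  have "successively E (rev a)" using a(2) sym by (auto simp: successively_rev intro: successively_mono)
  then have "successively E (rev a @ w @ b)"
    using a b w uv sym by (auto simp: successively_append_iff last_rev hd_append)
  moreover have "distinct (rev a @ w @ b)"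
    using a b w p ST by auto
  moreover have "length (rev a @ w @ b) = n" using a b w r by simp
  moreover have "hd (rev a @ w @ b) = x" using a by (simp add: hd_append hd_rev)
  moreover have "last (rev a @ w @ b) = y" using b by simp
  ultimately show ?thesis using that by blast
qed

end

section \<open>Monochromatic cycles and the induction on the number of colours\<close>

definition mono_cycle :: "('a set \<Rightarrow> nat) \<Rightarrow> nat \<Rightarrow> 'a set \<Rightarrow> nat \<Rightarrow> bool" where
  "mono_cycle c i V k \<longleftrightarrow> (\<exists>p. distinct p \<and> set p \<subseteq> V \<and> length p = k \<and>
     successively (\<lambda>u v. c {u, v} = i) p \<and> c {last p, hd p} = i)"

lemma mono_cycle_mono: "\<lbrakk>mono_cycle c i V k; V \<subseteq> V'\<rbrakk> \<Longrightarrow> mono_cycle c i V' k"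
  unfolding mono_cycle_def by blast

text \<open>The recursion says that \<open>13 * threshold t\<close> is squared in each step, so
  \<open>threshold t\<close> equals \<open>26 ^ (2 ^ t) / 13\<close>.\<close>

fun threshold :: "nat \<Rightarrow> nat" where
  "threshold 0 = 2"
| "threshold (Suc t) = 13 * (threshold t)\<^sup>2"

lemma threshold_ge_2: "2 \<le> threshold t"
proof (induction t)
  case (Suc t)
  have "threshold t \<le> (threshold t)\<^sup>2" by (simp add: power2_eq_square)
  then show ?case using Suc by simp
qed simp

text \<open>The bound fails for \<open>t = 1\<close>, where it reads 52 against 32. The step uses
  \<open>13 * 32 \<le> 35 ^ 2\<close>.\<close>

lemma threshold_le: "2 \<le> t \<Longrightarrow> threshold t \<le> 32 * 35 ^ (2 ^ t - 2)"
proof (induction t rule: dec_induct)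
  case base
  show ?case by (simp add: numeral_2_eq_2)
next
  case (step t)
  have "2 ^ Suc t - 2 = 2 * (2 ^ t - 2) + (2::nat)"
    using power_increasing[of 1 t "2::nat"] step by simp
  then have "(35::nat) ^ (2 ^ Suc t - 2) = (35 ^ (2 ^ t - 2))\<^sup>2 * 1225"
    by (simp add: power_add power_mult mult.commute[of 2])
  moreover have "(threshold t)\<^sup>2 \<le> (32 * 35 ^ (2 ^ t - 2))\<^sup>2"
    using step.IH by (rule power_mono) simp
  ultimately show ?case by (simp add: power_mult_distrib)
qed

text \<open>The exponent \<open>d\<close> stays fixed in the induction while \<open>V\<close> and
  \<open>m\<close> vary, so the lower bound on the cycle lengths is the same at every level.\<close>

lemma mono_cycle_or_complete_bipartite:
  fixes c :: "'a set \<Rightarrow> nat"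
  assumes "finite V" "threshold t * m \<le> card V" "0 < m" "threshold t * m \<le> 2 ^ d"
    and "\<And>i. i < t \<Longrightarrow> 2 * d + 2 \<le> n i \<and> n i \<le> m"
  shows "(\<exists>i<t. mono_cycle c i V (n i)) \<or>
    (\<exists>A B. A \<subseteq> V \<and> B \<subseteq> V \<and> A \<inter> B = {} \<and> card A = m \<and> card B = m \<and> (\<forall>a\<in>A. \<forall>b\<in>B. t \<le> c {a, b}))"
  using assms
proof (induction t arbitrary: V m)
  case 0
  then obtain A where A: "A \<subseteq> V" "card A = m" "finite A"
    using obtain_subset_with_card_n[of m V] by auto
  then have "m \<le> card (V - A)" using 0 by (simp add: card_Diff_subset)
  then obtain B where "B \<subseteq> V - A" "card B = m" "finite B" by (rule obtain_subset_with_card_n)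
  with A show ?case by (intro disjI2 exI[of _ A] exI[of _ B]) auto
next
  case (Suc t)
  define F where "F = threshold t"
  \<comment> \<open>The factor 13 yields \<open>25 * m \<le> k\<close> for the locale and leaves
    \<open>F * m\<close> vertices in \<open>A\<close> and in \<open>B\<close> after the deletion of
    \<open>W\<close>.\<close>
  define k where "k = 13 * F * m"
  have F: "2 \<le> F" using threshold_ge_2 by (simp add: F_def)
  have Fk: "F * k = threshold (Suc t) * m" by (simp add: k_def F_def power2_eq_square)
  have m_pos: "0 < m" by (rule Suc.prems)
  have mk: "26 * m \<le> k" using F by (simp add: k_def)
  have Fmk: "F * m + 2 * m \<le> k"
    using mult_le_mono1[OF F, of m] unfolding k_def by linarith
  have n: "2 * d + 2 \<le> n i" "n i \<le> m" if "i < Suc t" for i using Suc.prems(5)[OF that] by auto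
  have kd: "F * k \<le> 2 ^ d" using Suc.prems Fk by simp
  show ?case
  proof (rule ccontr)
    assume neg: "\<not> ?case"
    have no_cycle: "\<not> mono_cycle c i U (n i)" if "i < Suc t" "U \<subseteq> V" for i U
    proof
      assume "mono_cycle c i U (n i)"
      then have "mono_cycle c i V (n i)" using that(2) by (rule mono_cycle_mono)
      then show False using neg that(1) by blast
    qed
    have hole: "\<exists>a\<in>X. \<exists>b\<in>Y. c {a, b} < Suc t"
      if XY: "X \<subseteq> V" "Y \<subseteq> V" "X \<inter> Y = {}" "m \<le> card X" "m \<le> card Y" for X Y
    proof -
      obtain X' where X': "X' \<subseteq> X" "card X' = m" using XY(4) by (rule obtain_subset_with_card_n)
      obtain Y' where Y': "Y' \<subseteq> Y" "card Y' = m" using XY(5) by (rule obtain_subset_with_card_n)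
      have "X' \<subseteq> V" "Y' \<subseteq> V" "X' \<inter> Y' = {}" using X' Y' XY by auto
      then have "\<not> (\<forall>a\<in>X'. \<forall>b\<in>Y'. Suc t \<le> c {a, b})" using neg X'(2) Y'(2) by blast
      then show ?thesis using X'(1) Y'(1) by (auto simp: not_le)
    qed
    \<comment> \<open>\<open>m \<le> l\<close> keeps the cycle lengths admissible, and
      \<open>l \<le> k\<close> keeps \<open>F * l\<close> below \<open>2 ^ d\<close>.\<close>
    have IH: "\<exists>A B. A \<subseteq> U \<and> B \<subseteq> U \<and> A \<inter> B = {} \<and> card A = l \<and> card B = l \<and>
        (\<forall>a\<in>A. \<forall>b\<in>B. t \<le> c {a, b})"
      if U: "U \<subseteq> V" "F * l \<le> card U" "m \<le> l" "l \<le> k" for U l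
    proof -
      have "F * l \<le> 2 ^ d" using U kd mult_le_mono2[of l k F] by linarith
      moreover have "2 * d + 2 \<le> n i \<and> n i \<le> l" if "i < t" for i
        using n[of i] U(3) that by simp
      ultimately have "(\<exists>i<t. mono_cycle c i U (n i)) \<or> (\<exists>A B. A \<subseteq> U \<and> B \<subseteq> U \<and> A \<inter> B = {} \<and>
          card A = l \<and> card B = l \<and> (\<forall>a\<in>A. \<forall>b\<in>B. t \<le> c {a, b}))"
        using U Suc.prems(1) m_pos by (intro Suc.IH) (auto simp: F_def intro: finite_subset)
      then show ?thesis using no_cycle U by (meson less_SucI)
    qed
    obtain A B where AB: "A \<subseteq> V" "B \<subseteq> V" "A \<inter> B = {}" "card A = k" "card B = k"
      "\<forall>a\<in>A. \<forall>b\<in>B. t \<le> c {a, b}"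
      using IH[of V k] Suc.prems(2) Fk mk by auto
    define E where "E u v \<longleftrightarrow> (u \<in> A \<and> v \<in> B \<or> u \<in> B \<and> v \<in> A) \<and> c {u, v} = t" for u v
    interpret bipartite_hole_free E A B m
    proof
      show "finite A" "finite B" using AB Suc.prems(1) by (auto intro: finite_subset)
      show "\<exists>x\<in>X. \<exists>y\<in>Y. E x y" if XY: "X \<subseteq> A" "Y \<subseteq> B" "m \<le> card X" "m \<le> card Y" for X Y
      proof -
        have "X \<subseteq> V" "Y \<subseteq> V" "X \<inter> Y = {}" using XY AB by auto
        from hole[OF this XY(3,4)] obtain a b where "a \<in> X" "b \<in> Y" "c {a, b} < Suc t" by blast
        moreover from this have "t \<le> c {a, b}" using AB XY by blast
        ultimately show ?thesis unfolding E_def using XY by (intro bexI[of _ a] bexI[of _ b]) auto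
      qed
    qed (use AB mk m_pos in \<open>auto simp: E_def insert_commute\<close>)
    obtain W where W: "W \<subseteq> A \<union> B" "card W \<le> 2 * m"
      "\<And>S. \<lbrakk>S \<subseteq> A \<union> B - W; card S \<le> m\<rbrakk> \<Longrightarrow> 7 * card S \<le> card (nbrs S - W - S)"
      using ex_exceptional_set by blast
    have finW: "finite W" using W(1) finA finB by (meson finite_UnI finite_subset)
    have "F * m + 2 * m \<le> card A" "F * m + 2 * m \<le> card B" using AB Fmk by auto
    then have cA: "F * m \<le> card (A - W)" and cB: "F * m \<le> card (B - W)"
      using diff_card_le_card_Diff[OF finW, of A] diff_card_le_card_Diff[OF finW, of B] W(2)
      by linarith+
    have "m \<le> F * m" using mult_le_mono1[OF F, of m] by linarith
    \<comment> \<open>This is the closing edge of the cycle. It avoids \<open>W\<close> so that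
      trees grow from both ends; a path on \<open>n t\<close> vertices has its ends on the same side
      exactly when \<open>n t\<close> is odd.\<close>
    have "\<exists>x y. x \<in> A \<union> B - W \<and> y \<in> A \<union> B - W \<and> x \<noteq> y \<and> c {x, y} = t \<and>
        ((x \<in> A \<longleftrightarrow> y \<in> A) \<longleftrightarrow> odd (n t))"
    proof (cases "odd (n t)")
      case True
      have "A - W \<subseteq> V" using AB by blast
      then obtain X Y where XY: "X \<subseteq> A - W" "Y \<subseteq> A - W" "X \<inter> Y = {}" "card X = m" "card Y = m"
        "\<forall>a\<in>X. \<forall>b\<in>Y. t \<le> c {a, b}"
        using IH[of "A - W" m] cA mk by auto
      have "X \<subseteq> V" "Y \<subseteq> V" using XY(1,2) \<open>A - W \<subseteq> V\<close> by auto
      then obtain a b where ab: "a \<in> X" "b \<in> Y" "c {a, b} < Suc t"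
        using hole[of X Y] XY(3-5) by auto
      \<comment> \<open>The sets \<open>X\<close> and \<open>Y\<close> exclude colours below
        \<open>t\<close>, and \<open>hole\<close> excludes those above.\<close>
      then have "c {a, b} = t" using XY(6) by (simp add: le_antisym less_Suc_eq_le)
      then show ?thesis using ab XY True by (intro exI[of _ a] exI[of _ b]) auto
    next
      case False
      have "\<exists>x\<in>A - W. \<exists>y\<in>B - W. E x y"
        by (rule hole_free) (use le_trans[OF \<open>m \<le> F * m\<close> cA] le_trans[OF \<open>m \<le> F * m\<close> cB] in auto)
      then obtain x y where "x \<in> A - W" "y \<in> B - W" "E x y" by blast
      then show ?thesis using False disj by (intro exI[of _ x] exI[of _ y]) (auto simp: E_def)
    qed
    then obtain x y where xy: "x \<in> A \<union> B - W" "y \<in> A \<union> B - W" "x \<noteq> y" "c {x, y} = t"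
      "(x \<in> A \<longleftrightarrow> y \<in> A) \<longleftrightarrow> odd (n t)" by blast
    have "2 * m \<le> 2 ^ d"
    proof -
      have "2 * k \<le> F * k" using F by simp
      then show ?thesis using mk kd by linarith
    qed
    then obtain p where p: "distinct p" "successively E p" "length p = n t" "hd p = x" "last p = y"
      using ex_path_of_length[OF W(2) finW W(3) xy(1-3)] n[of t] xy(5) by blast
    have "set p \<subseteq> A \<union> B"
    proof
      fix z assume "z \<in> set p"
      then obtain i where i: "i < length p" "z = p ! i" by (auto simp: in_set_conv_nth)
      show "z \<in> A \<union> B"
      proof (cases i)
        case 0
        moreover have "p \<noteq> []" using i(1) by auto
        ultimately have "z = x" using i(2) p(4) by (simp add: hd_conv_nth)
        then show ?thesis using xy(1) by blast
      next
        case (Suc i')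
        then have "E (p ! i') z" using i p(2) by (simp add: successively_conv_nth)
        then show ?thesis using bip by blast
      qed
    qed
    moreover have "successively (\<lambda>u v. c {u, v} = t) p"
      using p(2) by (rule successively_mono) (simp_all add: E_def)
    moreover have "c {last p, hd p} = t" using p xy by (simp add: insert_commute)
    ultimately have "mono_cycle c t (A \<union> B) (n t)" using p unfolding mono_cycle_def by blast
    then show False using no_cycle[of t "A \<union> B"] AB by blast
  qed
qed

section \<open>Translation to graph copies and the Ramsey number\<close>

lemma has_mono_copy_cycle_graph:
  assumes "mono_cycle c i {..<N} k"
  shows "has_mono_copy N c (cycle_graph k) i"
proof -
  obtain p where p: "distinct p" "set p \<subseteq> {..<N}" "length p = k"
    "successively (\<lambda>u v. c {u, v} = i) p" "c {last p, hd p} = i"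
    using assms unfolding mono_cycle_def by blast
  have step: "c {p ! u, p ! ((u + 1) mod k)} = i" if "u < k" for u
  proof (cases "u + 1 < k")
    case True
    then show ?thesis using p by (simp add: successively_conv_nth)
  next
    case False
    then have "u + 1 = k" using that by simp
    moreover from this p(3) have "p \<noteq> []" by auto
    moreover from this have "last p = p ! (k - 1)" "hd p = p ! 0"
      using p(3) by (auto simp: last_conv_nth hd_conv_nth)
    ultimately show ?thesis using p(5) by auto
  qed
  have "inj_on ((!) p) {..<k}" using p by (auto simp: inj_on_def nth_eq_iff_index_eq)
  moreover have "(!) p ` {..<k} \<subseteq> {..<N}" using p by (auto dest: nth_mem)
  moreover have "c {p ! u, p ! v} = i"
    if "u < k" "v < k" "v = (u + 1) mod k \<or> u = (v + 1) mod k" for u v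
    using step[of u] step[of v] that by (auto simp: insert_commute)
  ultimately show ?thesis unfolding has_mono_copy_def cycle_graph_def
    by (intro exI[of _ "(!) p"]) auto
qed

text \<open>Allowing larger parts lets balanced parts of size \<open>max m1 m2\<close> serve for any
  \<open>m1\<close> and \<open>m2\<close>. The embedding glues two bijections at index
  \<open>a\<close>.\<close>

lemma has_mono_copy_complete_bipartite:
  assumes "A \<subseteq> {..<N}" "B \<subseteq> {..<N}" "A \<inter> B = {}" "a \<le> card A" "b \<le> card B"
    and col: "\<And>x y. \<lbrakk>x \<in> A; y \<in> B\<rbrakk> \<Longrightarrow> c {x, y} = i"
  shows "has_mono_copy N c (complete_bipartite a b) i"
proof -
  obtain A' where A': "A' \<subseteq> A" "card A' = a" "finite A'"
    using assms(4) by (rule obtain_subset_with_card_n)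
  obtain B' where B': "B' \<subseteq> B" "card B' = b" "finite B'"
    using assms(5) by (rule obtain_subset_with_card_n)
  obtain f where f: "bij_betw f {..<a} A'"
    using ex_bij_betw_nat_finite[OF A'(3)] A'(2) by (auto simp: atLeast0LessThan)
  obtain g where g: "bij_betw g {a..<a+b} B'"
    using finite_same_card_bij[of "{a..<a+b}" B'] B' by auto
  define h where "h u = (if u < a then f u else g u)" for u
  have hA: "h u \<in> A'" if "u < a" for u using f that by (auto simp: h_def bij_betw_def)
  have hB: "h u \<in> B'" if "a \<le> u" "u < a + b" for u using g that by (auto simp: h_def bij_betw_def)
  have "inj_on h {..<a+b}"
  proof (rule inj_onI)
    fix u v assume uv: "u \<in> {..<a+b}" "v \<in> {..<a+b}" "h u = h v"
    then have "u < a \<longleftrightarrow> v < a" using hA[of u] hA[of v] hB[of u] hB[of v] A' B' assms(3)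
      by (cases "u < a"; cases "v < a") auto
    then show "u = v" using uv f g by (auto simp: h_def bij_betw_def inj_on_def split: if_splits)
  qed
  moreover have "h ` {..<a+b} \<subseteq> {..<N}"
  proof
    fix z assume "z \<in> h ` {..<a+b}"
    then obtain u where "u < a + b" "z = h u" by auto
    then have "z \<in> A' \<union> B'" using hA[of u] hB[of u] by (cases "u < a") auto
    then show "z \<in> {..<N}" using A'(1) B'(1) assms(1,2) by blast
  qed
  moreover have "c {h u, h v} = i" "c {h v, h u} = i" if "u < a" "a \<le> v" "v < a + b" for u v
    using col[of "h u" "h v"] hA[of u] hB[of v] A'(1) B'(1) that by (auto simp: insert_commute)
  ultimately show ?thesis unfolding has_mono_copy_def complete_bipartite_def
    by (intro exI[of _ h]) auto
qed

theorem theorem2p11: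
  fixes t m1 m2 :: nat and n :: "nat \<Rightarrow> nat"
  assumes "t \<ge> 2" and "m1 > 0" and "m2 > 0"
    and "\<And>i. i \<in> {1..t} \<Longrightarrow> n i > 0"
    and "\<And>i. i \<in> {1..t} \<Longrightarrow> m2 \<ge> n i"
    and "\<And>i. i \<in> {1..t} \<Longrightarrow>
           int (n i) \<ge> 2 * \<lceil>log 2 (real (35 ^ (2 ^ t - 2) * (32 * m1 + 49 * m2)))\<rceil> + 2"
  shows "ramsey_number (map (\<lambda>i. cycle_graph (n i)) [1..<t+1] @ [complete_bipartite m1 m2])
           \<le> 35 ^ (2 ^ t - 2) * (32 * m1 + 49 * m2)"
proof -
  define N where "N = 35 ^ (2 ^ t - 2) * (32 * m1 + 49 * m2)"
  define m where "m = max m1 m2"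
  \<comment> \<open>Since \<open>N\<close> is positive, its logarithm is nonnegative and
    \<open>nat\<close> loses nothing.\<close>
  define d where "d = nat \<lceil>log 2 (real N)\<rceil>"
  have "0 < N" using assms(2) by (simp add: N_def)
  have log_le: "log 2 (real N) \<le> real d" unfolding d_def by linarith
  have "real N = 2 powr log 2 (real N)" using \<open>0 < N\<close> by simp
  also have "\<dots> \<le> 2 powr real d" using log_le by (intro powr_mono) auto
  also have "\<dots> = real (2 ^ d)" by (simp add: powr_realpow)
  finally have Nd: "N \<le> 2 ^ d" by (simp only: of_nat_le_iff)
  have "threshold t * m \<le> (32 * 35 ^ (2 ^ t - 2)) * m"
    using threshold_le[OF assms(1)] by (rule mult_le_mono1)
  also have "\<dots> = 35 ^ (2 ^ t - 2) * (32 * m)" by simp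
  also have "\<dots> \<le> N" unfolding N_def m_def by (intro mult_le_mono2) auto
  finally have mN: "threshold t * m \<le> N" .
  \<comment> \<open>Colours are numbered from 0 but cycle lengths from 1, hence
    \<open>Suc i\<close>.\<close>
  have n: "2 * d + 2 \<le> n (Suc i) \<and> n (Suc i) \<le> m" if "i < t" for i
  proof -
    have "0 \<le> log 2 (real N)" using \<open>0 < N\<close> by simp
    then have "int d = \<lceil>log 2 (real N)\<rceil>" by (simp add: d_def)
    then have "int (2 * d + 2) \<le> int (n (Suc i))"
      using assms(6)[of "Suc i"] that by (simp add: N_def)
    then show ?thesis using assms(5)[of "Suc i"] that by (simp add: m_def)
  qed
  let ?Gs = "map (\<lambda>i. cycle_graph (n i)) [1..<t+1] @ [complete_bipartite m1 m2]"
  have "ramsey_prop ?Gs N"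
    unfolding ramsey_prop_def
  proof (intro allI impI)
    fix c :: "nat set \<Rightarrow> nat"
    assume c: "\<forall>x<N. \<forall>y<N. x \<noteq> y \<longrightarrow> c {x, y} < length ?Gs"
    have "0 < m" using assms(2) by (simp add: m_def)
    then consider i where "i < t" "mono_cycle c i {..<N} (n (Suc i))"
      | A B where "A \<subseteq> {..<N}" "B \<subseteq> {..<N}" "A \<inter> B = {}" "card A = m" "card B = m"
        "\<forall>a\<in>A. \<forall>b\<in>B. t \<le> c {a, b}"
      using mono_cycle_or_complete_bipartite[of "{..<N}" t m d "\<lambda>i. n (Suc i)" c] mN Nd n by auto
    then show "\<exists>i<length ?Gs. has_mono_copy N c (?Gs ! i) i"
    proof cases
      case 1
      then have "?Gs ! i = cycle_graph (n (Suc i))" by (simp add: nth_append del: upt_Suc)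
      then show ?thesis using 1 has_mono_copy_cycle_graph[OF 1(2)]
        by (intro exI[of _ i]) (simp del: upt_Suc)
    next
      case 2
      \<comment> \<open>Only the \<open>t + 1\<close> colours up to \<open>t\<close> occur, so
        avoiding all cycle colours means having the last one.\<close>
      have "c {x, y} = t" if "x \<in> A" "y \<in> B" for x y
      proof -
        have "x < N" "y < N" "x \<noteq> y" using 2 that by auto
        then have "c {x, y} < Suc t" using c by (simp del: upt_Suc)
        then show ?thesis using 2(6) that by (simp add: le_antisym)
      qed
      then have "has_mono_copy N c (complete_bipartite m1 m2) t"
        using 2 by (intro has_mono_copy_complete_bipartite[of A N B]) (auto simp: m_def)
      moreover have "?Gs ! t = complete_bipartite m1 m2" by (simp add: nth_append del: upt_Suc)
      ultimately show ?thesis by (intro exI[of _ t]) (simp del: upt_Suc)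
    qed
  qed
  then show ?thesis unfolding ramsey_number_def N_def by (rule Least_le)
qed

end
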